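(* Let $n\ge 3$ and let $A=(a_{ij})$ be a symmetric $n\times n$ matrix with entries in $\mathbb{R}\cup\{-\infty\}$, and let $\delta_0,\delta_1,\ldots,\delta_n$ be the coefficients of its tropical characteristic polynomial, where $\delta_k$ is the coefficient of the term of degree $n-k$. Then at least one of the following inequalities holds: (1) $\delta_3+\delta_1\le 2\delta_2$; (2) $\delta_3+2\delta_0\le 3\delta_1$.
   Context: The tropical semiring is $\mathbb{R}_{\max}=\mathbb{R}\cup\{-\infty\}$ with $a\oplus b=\max\{a,b\}$ and $a\otimes b=a+b$, where $-\infty + a=-\infty$ for all $a$, $-\infty$ is the least element, and positive integer multiples of $-\infty$ equal $-\infty$. The sums, multiples and inequalities in the claim are the usual ones under these conventions. A matrix $A$ is symmetric if $a_{ij}=a_{ji}$ for all $i,j$. For a square matrix $B=(b_{ij})$ of order $k$ over $\mathbb{R}_{\max}$, its tropical permanent is $\operatorname{maper}(B)=\max_{\sigma\in S_k}\sum_{i=1}^k b_{i,\sigma(i)}$. The tropical characteristic polynomial of $A\in\mathbb{R}_{\max}^{n\times n}$ is $\operatorname{maper}(A\oplus x\otimes I)$, where $I$ has $0$ on the diagonal and $-\infty$ elsewhere. It is written $\bigoplus_{k=0}^n \delta_k\otimes x^{\otimes(n-k)}=\max_{0\le k\le n}(\delta_k+(n-k)x)$, with coefficients $\delta_0=0$ and, for $1\le k\le n$, $\delta_k=\max_B \operatorname{maper}(B)$, the maximum being over all principal submatrices $B$ of $A$ of order $k$ (same index set of size $k$ for rows and columns). *)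

theory Defs
  imports "HOL-Analysis.Analysis"
begin

text \<open>
  The tropical semiring is the part of \<^typ>\<open>ereal\<close> without \<^term>\<open>\<infinity> :: ereal\<close>; there
  \<open>max\<close>, \<open>+\<close>, \<open>\<le>\<close> and multiplication by positive integers follow the tropical conventions
  for \<open>-\<infinity>\<close>. That a matrix has entries in the tropical semiring is thus the condition that
  no entry is \<^term>\<open>\<infinity> :: ereal\<close>.
\<close>

definition tropical_matrix :: "ereal ^ 'n ^ 'n \<Rightarrow> bool" where
  "tropical_matrix A \<longleftrightarrow> (\<forall>i j. A $ i $ j \<noteq> \<infinity>)"

definition symmetric_matrix :: "'a ^ 'n ^ 'n \<Rightarrow> bool" where
  "symmetric_matrix A \<longleftrightarrow> (\<forall>i j. A $ i $ j = A $ j $ i)"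

text \<open>
  The tropical permanent of the principal submatrix of \<open>A\<close> with row and column index set \<open>S\<close>,
  a square matrix of order \<open>card S\<close>; the permanent of \<open>A\<close> itself is the case \<open>S = UNIV\<close>.
\<close>

definition maper :: "'n set \<Rightarrow> ereal ^ 'n ^ 'n \<Rightarrow> ereal" where
  "maper S A = Max ((\<lambda>\<sigma>. \<Sum>i\<in>S. A $ i $ \<sigma> i) ` {\<sigma>. \<sigma> permutes S})"

definition trop_identity :: "ereal ^ 'n ^ 'n" where
  "trop_identity = (\<chi> i j. if i = j then 0 else -\<infinity>)"

definition trop_charpoly :: "ereal ^ 'n ^ 'n \<Rightarrow> ereal \<Rightarrow> ereal" where
  "trop_charpoly A x = maper UNIV (\<chi> i j. max (A $ i $ j) (x + trop_identity $ i $ j))"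

text \<open>
  The coefficient \<open>\<delta>\<^sub>k\<close> of the term of degree \<open>n - k\<close>, for \<open>k \<le> n = CARD('n)\<close>. A tropical
  polynomial function does not determine its coefficients, so they are given by the formula
  in terms of principal submatrices; lemma \<open>trop_charpoly_expansion\<close> below shows that they
  expand the characteristic polynomial.
\<close>

definition trop_charpoly_coeff :: "ereal ^ 'n ^ 'n \<Rightarrow> nat \<Rightarrow> ereal" where
  "trop_charpoly_coeff A k =
     (if k = 0 then 0 else Max ((\<lambda>S. maper S A) ` {S. card S = k}))"

lemma maper_ge:
  fixes A :: "ereal ^ 'n ^ 'n"
  assumes "\<sigma> permutes S"
  shows "(\<Sum>i\<in>S. A $ i $ \<sigma> i) \<le> maper S A"
  unfolding maper_def using assms by (intro Max_ge) (auto simp: finite_permutations)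

lemma maper_attained:
  fixes A :: "ereal ^ 'n ^ 'n"
  obtains \<sigma> where "\<sigma> permutes S" "maper S A = (\<Sum>i\<in>S. A $ i $ \<sigma> i)"
proof -
  have "maper S A \<in> (\<lambda>\<sigma>. \<Sum>i\<in>S. A $ i $ \<sigma> i) ` {\<sigma>. \<sigma> permutes S}"
    unfolding maper_def
    by (intro Max_in) (auto simp: finite_permutations intro: permutes_id)
  then show thesis using that by auto
qed

lemma trop_charpoly_coeff_ge:
  fixes A :: "ereal ^ 'n ^ 'n"
  shows "maper S A \<le> trop_charpoly_coeff A (card S)"
proof (cases "S = {}")
  case True
  then show ?thesis by (simp add: trop_charpoly_coeff_def maper_def)
next
  case False
  then have "card S \<noteq> 0" by simp
  then show ?thesis unfolding trop_charpoly_coeff_def by (auto intro!: Max_ge)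
qed

lemma trop_charpoly_coeff_attained:
  fixes A :: "ereal ^ 'n ^ 'n"
  assumes "k \<le> CARD('n)"
  obtains S where "card S = k" "trop_charpoly_coeff A k = maper S A"
proof (cases "k = 0")
  case True
  then show thesis using that[of "{}"] by (simp add: trop_charpoly_coeff_def maper_def)
next
  case False
  obtain T :: "'n set" where "card T = k"
    using assms obtain_subset_with_card_n by blast
  then have "Max ((\<lambda>S. maper S A) ` {S. card S = k}) \<in> (\<lambda>S. maper S A) ` {S. card S = k}"
    by (intro Max_in) auto
  then show thesis using that False by (auto simp: trop_charpoly_coeff_def)
qed

lemma card_complement: "card (- S) = CARD('n) - card S" for S :: "'n::finite set"
  by (simp add: Compl_eq_Diff_UNIV card_Diff_subset)

lemma trop_charpoly_expansion:
  fixes A :: "ereal ^ 'n ^ 'n"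
  assumes x: "x \<noteq> \<infinity>"
  shows "trop_charpoly A x =
    Max ((\<lambda>k. trop_charpoly_coeff A k + ereal (real (CARD('n) - k)) * x) ` {0..CARD('n)})"
    (is "_ = Max (?f ` _)")
proof (rule antisym)
  let ?B = "\<chi> i j. max (A $ i $ j) (x + trop_identity $ i $ j)"
  obtain \<sigma> where \<sigma>: "\<sigma> permutes (UNIV :: 'n set)"
    and eq: "trop_charpoly A x = (\<Sum>i\<in>UNIV. ?B $ i $ \<sigma> i)"
    unfolding trop_charpoly_def by (rule maper_attained)
  define S where "S = {i. x + trop_identity $ i $ \<sigma> i \<le> A $ i $ \<sigma> i}"
  have fixed: "\<sigma> i = i" if "i \<notin> S" for i
  proof (rule ccontr)
    assume "\<sigma> i \<noteq> i"
    with x have "x + trop_identity $ i $ \<sigma> i = -\<infinity>"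
      by (simp add: trop_identity_def)
    with that show False by (simp add: S_def)
  qed
  have perm: "\<sigma> permutes S"
    using \<sigma> fixed unfolding permutes_def by blast
  have on_S: "(\<Sum>i\<in>S. ?B $ i $ \<sigma> i) = (\<Sum>i\<in>S. A $ i $ \<sigma> i)"
    by (intro sum.cong refl) (simp add: S_def)
  have "?B $ i $ \<sigma> i = x" if "i \<notin> S" for i
    using that fixed[OF that] by (simp add: S_def trop_identity_def not_le)
  then have "(\<Sum>i\<in>-S. ?B $ i $ \<sigma> i) = (\<Sum>i\<in>-S. x)"
    by (intro sum.cong refl) blast
  then have off_S: "(\<Sum>i\<in>-S. ?B $ i $ \<sigma> i) = ereal (real (CARD('n) - card S)) * x"
    by (simp only: sum_constant_ereal card_complement mult.commute[of x])
  have "trop_charpoly A x = (\<Sum>i\<in>S. ?B $ i $ \<sigma> i) + (\<Sum>i\<in>-S. ?B $ i $ \<sigma> i)"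
    unfolding eq by (simp add: sum.union_disjoint[symmetric])
  also have "\<dots> = (\<Sum>i\<in>S. A $ i $ \<sigma> i) + ereal (real (CARD('n) - card S)) * x"
    by (simp only: on_S off_S)
  also have "\<dots> \<le> ?f (card S)"
    by (intro add_right_mono order.trans[OF maper_ge[OF perm] trop_charpoly_coeff_ge])
  also have "\<dots> \<le> Max (?f ` {0..CARD('n)})"
    by (intro Max_ge imageI) (simp_all add: card_mono)
  finally show "trop_charpoly A x \<le> Max (?f ` {0..CARD('n)})" .
next
  let ?B = "\<chi> i j. max (A $ i $ j) (x + trop_identity $ i $ j)"
  have "?f k \<le> trop_charpoly A x" if k: "k \<le> CARD('n)" for k
  proof -
    obtain S :: "'n set" where S: "card S = k" "trop_charpoly_coeff A k = maper S A"
      using trop_charpoly_coeff_attained[OF k] by blast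
    obtain \<sigma> where \<sigma>: "\<sigma> permutes S" "maper S A = (\<Sum>i\<in>S. A $ i $ \<sigma> i)"
      by (rule maper_attained)
    have "?f k = (\<Sum>i\<in>S. A $ i $ \<sigma> i) + (\<Sum>i\<in>-S. x)"
      using S \<sigma> by (simp only: sum_constant_ereal card_complement mult.commute[of x])
    also have "\<dots> \<le> (\<Sum>i\<in>S. ?B $ i $ \<sigma> i) + (\<Sum>i\<in>-S. ?B $ i $ \<sigma> i)"
      using permutes_not_in[OF \<sigma>(1)]
      by (intro add_mono sum_mono) (auto simp: trop_identity_def)
    also have "\<dots> = (\<Sum>i\<in>UNIV. ?B $ i $ \<sigma> i)"
      by (simp add: sum.union_disjoint[symmetric])
    also have "\<dots> \<le> trop_charpoly A x"
      unfolding trop_charpoly_def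
      by (intro maper_ge permutes_subset[OF \<sigma>(1)]) auto
    finally show ?thesis .
  qed
  then show "Max (?f ` {0..CARD('n)}) \<le> trop_charpoly A x"
    by (subst Max_le_iff) auto
qed

end

theory Submission
  imports Defs
begin

text \<open>
  Let \<open>M\<close> be the largest entry of \<open>A\<close>, so that \<open>\<delta>\<^sub>k \<le> k M\<close> for all \<open>k\<close>. If \<open>M\<close> occurs on the
  diagonal, then \<open>\<delta>\<^sub>1 = M\<close> and (2) holds. If \<open>M\<close> occurs off the diagonal, then by symmetry the
  transposition of its row and column index gives \<open>2 M \<le> \<delta>\<^sub>2\<close>, whence
  \<open>\<delta>\<^sub>3 + \<delta>\<^sub>1 \<le> 3 M + M \<le> 2 \<delta>\<^sub>2\<close>, which is (1).
\<close>

text \<open>The maximum is attained by one permutation of one index set of size \<open>k\<close>;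
  its weight is a sum of \<open>k\<close> entries, each at most \<open>M\<close>.\<close>

lemma trop_charpoly_coeff_le:
  fixes A :: "ereal ^ 'n ^ 'n"
  assumes "\<And>i j. A $ i $ j \<le> M" and "k \<le> CARD('n)"
  shows "trop_charpoly_coeff A k \<le> ereal (real k) * M"
proof -
  obtain S :: "'n set" where S: "card S = k" "trop_charpoly_coeff A k = maper S A"
    using trop_charpoly_coeff_attained[OF assms(2)] by blast
  obtain \<sigma> where "maper S A = (\<Sum>i\<in>S. A $ i $ \<sigma> i)"
    by (rule maper_attained)
  also have "\<dots> \<le> (\<Sum>i\<in>S. M)"
    by (intro sum_mono assms(1))
  also have "\<dots> = ereal (real k) * M"
    by (simp only: sum_constant_ereal S(1) mult.commute)
  finally show ?thesis
    using S(2) by simp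
qed

lemma diagonal_le_trop_charpoly_coeff_1:
  fixes A :: "ereal ^ 'n ^ 'n"
  shows "A $ p $ p \<le> trop_charpoly_coeff A 1"
  using order.trans[OF maper_ge[OF permutes_id, where S = "{p}" and A = A]
      trop_charpoly_coeff_ge]
  by simp

text \<open>Swapping \<open>p\<close> and \<open>q\<close> is one of the permutations competing in
  the permanent on \<open>{p, q}\<close>.\<close>

lemma transposition_le_trop_charpoly_coeff_2:
  fixes A :: "ereal ^ 'n ^ 'n"
  assumes "p \<noteq> q"
  shows "A $ p $ q + A $ q $ p \<le> trop_charpoly_coeff A 2"
proof -
  have "Transposition.transpose p q permutes {p, q}"
    by (intro permutes_swap_id) auto
  from order.trans[OF maper_ge[OF this, where A = A] trop_charpoly_coeff_ge] show ?thesis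
    using assms by (simp add: numeral_2_eq_2)
qed

theorem theorem4p1:
  fixes A :: "ereal ^ 'n ^ 'n"
  assumes "CARD('n) \<ge> 3"
    and "tropical_matrix A"
    and "symmetric_matrix A"
  shows "trop_charpoly_coeff A 3 + trop_charpoly_coeff A 1 \<le> 2 * trop_charpoly_coeff A 2
    \<or> trop_charpoly_coeff A 3 + 2 * trop_charpoly_coeff A 0 \<le> 3 * trop_charpoly_coeff A 1"
proof -
  define M where "M = Max (range (\<lambda>(i, j). A $ i $ j))"
  have le_M: "A $ i $ j \<le> M" for i j
    unfolding M_def by (rule Max_ge) (auto intro: image_eqI[of _ _ "(i, j)"])
  have "M \<in> range (\<lambda>(i, j). A $ i $ j)"
    unfolding M_def by (rule Max_in) auto
  then obtain p q where M: "M = A $ p $ q"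
    by auto
  have \<delta>3: "trop_charpoly_coeff A 3 \<le> 3 * M"
    using trop_charpoly_coeff_le[OF le_M assms(1)] by simp
  show ?thesis
  proof (cases "p = q")
    case True
    then have "M \<le> trop_charpoly_coeff A 1"
      using diagonal_le_trop_charpoly_coeff_1 M by metis
    then have "3 * M \<le> 3 * trop_charpoly_coeff A 1"
      by (intro ereal_mult_left_mono) auto
    with \<delta>3 have "trop_charpoly_coeff A 3 \<le> 3 * trop_charpoly_coeff A 1"
      by (rule order.trans)
    \<comment> \<open>The coefficient of index 0 is 0, so its double vanishes in (2).\<close>
    then show ?thesis
      by (simp add: trop_charpoly_coeff_def[where k = 0])
  next
    case False
    have "trop_charpoly_coeff A 1 \<le> M"
      using trop_charpoly_coeff_le[OF le_M, where k = 1] assms(1) by simp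
    with \<delta>3 have "trop_charpoly_coeff A 3 + trop_charpoly_coeff A 1 \<le> 3 * M + M"
      by (rule add_mono)
    \<comment> \<open>Distributivity can fail in \<open>ereal\<close>, so infinite \<open>M\<close>
      is split off.\<close>
    also have "\<dots> = 2 * (M + M)"
      by (cases M) auto
    also have "\<dots> \<le> 2 * trop_charpoly_coeff A 2"
      using transposition_le_trop_charpoly_coeff_2[OF False, of A] assms(3) M
      by (intro ereal_mult_left_mono) (auto simp: symmetric_matrix_def)
    finally show ?thesis ..
  qed
qed

end
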